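(* Let $X$ be a finite set with $n\geq 1$ elements and let $m=\lfloor n/2\rfloor$. Then: (1) The maximum cardinality of a commutative nilpotent subsemigroup of $\mathcal{I}(X)$ is $$\lambda_n=\sum_{r=0}^m\binom{m}{r}\binom{n-m}{r}r!.$$ (2) If $n\notin\{1,3\}$, then the only commutative nilpotent subsemigroups of $\mathcal{I}(X)$ of order $\lambda_n$ are the balanced null semigroups $S_{K,L}$.
   Context: For a finite set $X$, $\mathcal{I}(X)$ is the symmetric inverse semigroup on $X$: all partial injective transformations of $X$ (injective functions whose domain and image are subsets of $X$) under composition of partial functions, written from left to right. Its zero (the empty map) is denoted $0$. A subsemigroup $S$ of $\mathcal{I}(X)$ is nilpotent if every $\alpha\in S$ is nilpotent, i.e. $\alpha^p=0$ for some positive integer $p$. For $n=|X|\geq 2$ and a partition $\{K,L\}$ of $X$ into two nonempty sets, $S_{K,L}$ is the set of all $\alpha\in\mathcal{I}(X)$ with $\operatorname{dom}(\alpha)\subseteq K$ and $\operatorname{im}(\alpha)\subseteq L$ (including $0$). It is a semigroup in which every product is $0$. It is called a balanced null semigroup if $|K|=\lfloor n/2\rfloor$ and $|L|=n-\lfloor n/2\rfloor$, or vice versa. *)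

theory Defs
  imports Main
begin

text \<open>Partial transformations of a set \<open>X\<close> are represented by partial maps whose domain and
  range are contained in \<open>X\<close>; the zero is \<open>Map.empty\<close>.\<close>

definition sym_inv_semigroup :: "'a set \<Rightarrow> ('a \<rightharpoonup> 'a) set" where
  "sym_inv_semigroup X = {\<alpha>. dom \<alpha> \<subseteq> X \<and> ran \<alpha> \<subseteq> X \<and> inj_on \<alpha> (dom \<alpha>)}"

text \<open>Composition is written from left to right: \<open>\<alpha> \<Zsemi> \<beta>\<close> applies \<open>\<alpha>\<close> first.\<close>

definition pcomp :: "('a \<rightharpoonup> 'a) \<Rightarrow> ('a \<rightharpoonup> 'a) \<Rightarrow> ('a \<rightharpoonup> 'a)"  (infixl \<open>\<Zsemi>\<close> 75) where
  "\<alpha> \<Zsemi> \<beta> = \<beta> \<circ>\<^sub>m \<alpha>"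

text \<open>Exponent \<open>0\<close> gives the identity of the whole type, which need not lie in the symmetric
  inverse semigroup on \<open>X\<close>; only positive exponents are used below.\<close>

primrec ppow :: "('a \<rightharpoonup> 'a) \<Rightarrow> nat \<Rightarrow> ('a \<rightharpoonup> 'a)" where
  "ppow \<alpha> 0 = Some"
| "ppow \<alpha> (Suc p) = ppow \<alpha> p \<Zsemi> \<alpha>"

definition nilpotent_map :: "('a \<rightharpoonup> 'a) \<Rightarrow> bool" where
  "nilpotent_map \<alpha> \<longleftrightarrow> (\<exists>p>0. ppow \<alpha> p = Map.empty)"

definition subsemigroup :: "'a set \<Rightarrow> ('a \<rightharpoonup> 'a) set \<Rightarrow> bool" where
  "subsemigroup X S \<longleftrightarrow>
     S \<noteq> {} \<and> S \<subseteq> sym_inv_semigroup X \<and> (\<forall>\<alpha>\<in>S. \<forall>\<beta>\<in>S. \<alpha> \<Zsemi> \<beta> \<in> S)"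

definition commutative_nilpotent_subsemigroup :: "'a set \<Rightarrow> ('a \<rightharpoonup> 'a) set \<Rightarrow> bool" where
  "commutative_nilpotent_subsemigroup X S \<longleftrightarrow>
     subsemigroup X S \<and> (\<forall>\<alpha>\<in>S. \<forall>\<beta>\<in>S. \<alpha> \<Zsemi> \<beta> = \<beta> \<Zsemi> \<alpha>) \<and> (\<forall>\<alpha>\<in>S. nilpotent_map \<alpha>)"

definition null_semigroup :: "'a set \<Rightarrow> 'a set \<Rightarrow> 'a set \<Rightarrow> ('a \<rightharpoonup> 'a) set" where
  "null_semigroup X K L = {\<alpha> \<in> sym_inv_semigroup X. dom \<alpha> \<subseteq> K \<and> ran \<alpha> \<subseteq> L}"

definition balanced_null_semigroup :: "'a set \<Rightarrow> ('a \<rightharpoonup> 'a) set \<Rightarrow> bool" where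
  "balanced_null_semigroup X S \<longleftrightarrow>
     (\<exists>K L. K \<noteq> {} \<and> L \<noteq> {} \<and> K \<inter> L = {} \<and> K \<union> L = X \<and>
        (card K = card X div 2 \<and> card L = card X - card X div 2 \<or>
         card L = card X div 2 \<and> card K = card X - card X div 2) \<and>
        S = null_semigroup X K L)"

end

theory Submission
  imports Defs "HOL-Library.FuncSet"
begin

text \<open>Let \<open>A\<close> be the set of points of \<open>X\<close> in the image of no element of \<open>S\<close>. By nilpotency every
  other point is \<open>x \<alpha>\<close> with \<open>x \<in> A\<close> and \<open>\<alpha> \<in> S\<close>, and then \<open>(x \<alpha>) \<gamma> = (x \<gamma>) \<alpha>\<close>; so every
  \<open>\<gamma> \<in> S\<close> is determined by its restriction to \<open>A\<close>, a partial injection from \<open>A\<close> to \<open>X - A\<close>.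
  The number of those is largest when \<open>A\<close> is half of \<open>X\<close>. If the bound is attained, then every
  partial injection from \<open>A\<close> to \<open>X - A\<close> extends to an element of \<open>S\<close>. Commuting two extensions of
  one-point maps with different sources (these exist when \<open>A\<close> has two points) shows that such
  extensions are defined at one point only, and from this that all domains lie in \<open>A\<close>.\<close>

section \<open>Counting partial injections\<close>

lemma Suc_times_binomial_Suc: "Suc r * (n choose Suc r) = (n - r) * (n choose r)"
proof (cases "r \<le> n")
  case True
  then show ?thesis
    by (metis binomial_absorb_comp binomial_absorption)
qed (simp add: binomial_eq_0)

lemma prod_diff_eq_binomial_fact: "(\<Prod>i = 0..<r. n - i) = (n choose r) * fact r" for n r :: nat
proof (induction r)
  case (Suc r)
  have "(\<Prod>i = 0..<Suc r. n - i) = ((n - r) * (n choose r)) * fact r"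
    by (simp add: Suc)
  also have "\<dots> = (n choose Suc r) * fact (Suc r)"
    using Suc_times_binomial_Suc[of r n] by (simp only: fact_Suc of_nat_id ac_simps)
  finally show ?case .
qed simp

text \<open>Partial maps with domain \<open>D\<close> correspond to extensional functions on
  \<open>D\<close> via \<open>g\<close>, which preserves injectivity. This reduces the count to the
  known falling factorial for injective functions.\<close>

lemma card_injective_maps_dom:
  assumes "finite D" "finite L"
  shows "card {\<alpha>. dom \<alpha> = D \<and> ran \<alpha> \<subseteq> L \<and> inj_on \<alpha> D} = (card L choose card D) * fact (card D)"
    (is "card ?M = _")
proof -
  define g :: "('a \<Rightarrow> 'b) \<Rightarrow> ('a \<rightharpoonup> 'b)" where "g f = (\<lambda>x. if x \<in> D then Some (f x) else None)" for f
  let ?F = "{f \<in> D \<rightarrow>\<^sub>E L. inj_on f D}"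
  have "inj_on g ?F"
  proof (rule inj_onI)
    fix f h assume "f \<in> ?F" "h \<in> ?F" and eq: "g f = g h"
    have "f x = h x" if "x \<in> D" for x
      using fun_cong[OF eq, of x] that by (simp add: g_def)
    with \<open>f \<in> ?F\<close> \<open>h \<in> ?F\<close> show "f = h"
      by (auto intro: PiE_ext)
  qed
  moreover have "g ` ?F = ?M"
  proof (intro equalityI subsetI)
    fix \<alpha> assume "\<alpha> \<in> g ` ?F"
    then show "\<alpha> \<in> ?M"
      by (auto simp: g_def dom_def ran_def inj_on_def split: if_splits)
  next
    fix \<alpha> assume \<alpha>: "\<alpha> \<in> ?M"
    let ?f = "\<lambda>x\<in>D. the (\<alpha> x)"
    have some: "\<exists>y. \<alpha> x = Some y" if "x \<in> D" for x
      using \<alpha> that by auto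
    have "inj_on ?f D"
    proof (rule inj_onI)
      fix x y assume "x \<in> D" "y \<in> D" "?f x = ?f y"
      then have "\<alpha> x = \<alpha> y"
        using some[of x] some[of y] by auto
      with \<alpha> \<open>x \<in> D\<close> \<open>y \<in> D\<close> show "x = y"
        by (auto dest: inj_onD)
    qed
    moreover have "?f x \<in> L" if "x \<in> D" for x
      using some[OF that] \<alpha> that by (auto intro: ranI)
    ultimately have "?f \<in> ?F"
      by simp
    moreover have "\<alpha> = g ?f"
    proof
      fix x
      show "\<alpha> x = g ?f x"
        using some[of x] \<alpha> by (cases "x \<in> D") (auto simp: g_def)
    qed
    ultimately show "\<alpha> \<in> g ` ?F"
      by blast
  qed
  ultimately have "card ?M = card ?F"
    using card_image[of g ?F] by simp
  then show ?thesis
    using card_inj_on_subset_funcset[OF assms, of D] by (simp add: prod_diff_eq_binomial_fact)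
qed

text \<open>The number of partial injections from a \<open>k\<close>-set to its complement in an
  \<open>n\<close>-set: \<open>r\<close> is the rank, and the factors choose domain, image and
  bijection. Summing up to \<open>n\<close> gives the same range for every \<open>k\<close>; terms
  with \<open>r > k\<close> vanish.\<close>

definition num_partial_inj :: "nat \<Rightarrow> nat \<Rightarrow> nat" where
  "num_partial_inj n k = (\<Sum>r\<le>n. (k choose r) * ((n - k) choose r) * fact r)"

lemma finite_null_semigroup:
  assumes "finite X"
  shows "finite (null_semigroup X K L)"
proof (rule finite_subset)
  show "null_semigroup X K L \<subseteq> (\<Union>D\<in>Pow X. {\<alpha>. dom \<alpha> = D \<and> ran \<alpha> \<subseteq> X})"
    by (auto simp: null_semigroup_def sym_inv_semigroup_def)
  show "finite (\<Union>D\<in>Pow X. {\<alpha>. dom \<alpha> = D \<and> ran \<alpha> \<subseteq> X})"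
    using assms by (intro finite_UN_I finite_set_of_finite_maps) (auto intro: finite_subset)
qed

lemma card_null_semigroup:
  assumes "finite X" "K \<inter> L = {}" "K \<union> L = X"
  shows "card (null_semigroup X K L) = num_partial_inj (card X) (card K)"
proof -
  let ?M = "\<lambda>D. {\<alpha>. dom \<alpha> = D \<and> ran \<alpha> \<subseteq> L \<and> inj_on \<alpha> D}"
  let ?w = "\<lambda>r. (card L choose r) * fact r"
  have fin: "finite K" "finite L" and L: "card L = card X - card K" and le: "card K \<le> card X"
    using assms by (auto simp: card_Un_disjoint)
  have eq: "null_semigroup X K L = (\<Union>D\<in>Pow K. ?M D)"
    using assms by (auto simp: null_semigroup_def sym_inv_semigroup_def)
  have "card (null_semigroup X K L) = (\<Sum>D\<in>Pow K. card (?M D))"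
    unfolding eq
  proof (rule card_UN_disjoint)
    have "finite (?M D)" if "D \<subseteq> K" for D
      using that fin(1)
      by (intro finite_subset[OF _ finite_set_of_finite_maps[OF _ fin(2), of D]])
        (auto intro: finite_subset)
    then show "\<forall>D\<in>Pow K. finite (?M D)"
      by simp
  qed (use fin in auto)
  also have "\<dots> = (\<Sum>D\<in>Pow K. ?w (card D))"
    using fin by (intro sum.cong refl card_injective_maps_dom) (auto intro: finite_subset)
  \<comment> \<open>The summand depends on \<open>D\<close> only through its size, so the domains
    are grouped by rank.\<close>
  also have "\<dots> = (\<Sum>r\<le>card X. \<Sum>D\<in>{D \<in> Pow K. card D = r}. ?w (card D))"
    using fin le by (intro sum.group[symmetric]) (auto dest: card_mono[OF fin(1)])
  also have "\<dots> = (\<Sum>r\<le>card X. (card K choose r) * ?w r)"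
    using n_subsets[OF fin(1)] by (intro sum.cong refl) simp
  finally show ?thesis
    by (simp add: num_partial_inj_def L mult.assoc)
qed

section \<open>Maximising \<open>num_partial_inj n k\<close> over \<open>k\<close>\<close>

lemma num_partial_inj_sym: "k \<le> n \<Longrightarrow> num_partial_inj n (n - k) = num_partial_inj n k"
  by (simp add: num_partial_inj_def mult.commute)

text \<open>Moving one point from the larger block to the smaller one loses no maps of rank
  \<open>r\<close>. By Pascal's rule both sides share \<open>(k choose r) * (l choose r)\<close>;
  after multiplying by \<open>r = Suc s\<close>, the remaining terms compare as \<open>k - s\<close>
  with \<open>l - s\<close>.\<close>

lemma binomial_mult_binomial_Suc_le:
  assumes "k \<le> l"
  shows "(k choose r) * (Suc l choose r) \<le> (Suc k choose r) * (l choose r)"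
proof (cases r)
  case (Suc s)
  have "Suc s * ((k choose Suc s) * (l choose s)) \<le> Suc s * ((l choose Suc s) * (k choose s))"
  proof -
    have "Suc s * ((k choose Suc s) * (l choose s)) = (k - s) * ((k choose s) * (l choose s))"
      using Suc_times_binomial_Suc[of s k] by (simp only: mult.assoc[symmetric])
    also have "\<dots> \<le> (l - s) * ((k choose s) * (l choose s))"
      using assms by (intro mult_right_mono) auto
    also have "\<dots> = Suc s * (l choose Suc s) * (k choose s)"
      by (simp only: Suc_times_binomial_Suc ac_simps)
    finally show ?thesis
      by (simp only: mult.assoc)
  qed
  then have "(k choose Suc s) * (l choose s) \<le> (l choose Suc s) * (k choose s)"
    by (rule mult_left_le_imp_le) simp
  then show ?thesis
    by (simp add: Suc algebra_simps)
qed simp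

text \<open>The comparison is termwise with \<open>l = n - Suc k\<close>. Strictness requires
  \<open>k < l\<close>: at \<open>k = l\<close> the two block sizes merely swap and the values
  agree.\<close>

lemma num_partial_inj_less_Suc:
  assumes "2 * k + 1 < n"
  shows "num_partial_inj n k < num_partial_inj n (Suc k)"
  unfolding num_partial_inj_def
proof (rule sum_strict_mono_ex1)
  have n: "n - k = Suc (n - Suc k)" and le: "k \<le> n - Suc k" "k < n - Suc k"
    using assms by auto
  show "\<forall>r\<in>{..n}. (k choose r) * (n - k choose r) * fact r
      \<le> (Suc k choose r) * (n - Suc k choose r) * fact r"
    unfolding n using binomial_mult_binomial_Suc_le[OF le(1)] by simp
  \<comment> \<open>Rank 1 supplies the strict term: the product of the block sizes grows.\<close>
  have "k * Suc (n - Suc k) < Suc k * (n - Suc k)"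
    using le by simp
  then show "\<exists>r\<in>{..n}. (k choose r) * (n - k choose r) * fact r
      < (Suc k choose r) * (n - Suc k choose r) * fact r"
    unfolding n using assms by (intro bexI[of _ 1]) auto
qed simp

lemma num_partial_inj_less_half:
  assumes "k < n div 2"
  shows "num_partial_inj n k < num_partial_inj n (n div 2)"
  using assms
proof (induction rule: strict_inc_induct)
  case (base i)
  then have "2 * i + 1 < n" by linarith
  from num_partial_inj_less_Suc[OF this] base show ?case by simp
next
  case (step i)
  then have "2 * i + 1 < n" by linarith
  from num_partial_inj_less_Suc[OF this] step show ?case by simp
qed

lemma num_partial_inj_less:
  assumes "k \<le> n" "k \<noteq> n div 2" "k \<noteq> n - n div 2"
  shows "num_partial_inj n k < num_partial_inj n (n div 2)"
proof (cases "k < n div 2")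
  case False
  \<comment> \<open>The two halves are equal or consecutive, so \<open>k\<close> lies above both,
    and the symmetry reflects it below them.\<close>
  with assms have "n - k < n div 2" by linarith
  then show ?thesis
    using num_partial_inj_less_half num_partial_inj_sym assms(1) by metis
qed (rule num_partial_inj_less_half)

lemma num_partial_inj_le: "k \<le> n \<Longrightarrow> num_partial_inj n k \<le> num_partial_inj n (n div 2)"
  using num_partial_inj_less[of k n] num_partial_inj_sym[of "n div 2" n] by fastforce

lemma num_partial_inj_half:
  "num_partial_inj n (n div 2)
    = (\<Sum>r = 0..n div 2. (n div 2 choose r) * ((n - n div 2) choose r) * fact r)"
  unfolding num_partial_inj_def by (rule sum.mono_neutral_right) (auto simp: binomial_eq_0)

section \<open>Null semigroups\<close>

text \<open>Every product is zero, since images lie in \<open>L\<close> and domains in the disjoint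
  set \<open>K\<close>. In particular all squares vanish.\<close>

lemma null_semigroup_commutative_nilpotent:
  assumes "K \<inter> L = {}"
  shows "commutative_nilpotent_subsemigroup X (null_semigroup X K L)"
proof -
  have zero: "Map.empty \<in> null_semigroup X K L"
    by (simp add: null_semigroup_def sym_inv_semigroup_def)
  have comp: "\<alpha> \<Zsemi> \<beta> = Map.empty" if "\<alpha> \<in> null_semigroup X K L" "\<beta> \<in> null_semigroup X K L" for \<alpha> \<beta>
  proof
    fix x
    have "y \<in> L" if "\<alpha> x = Some y" for y
      using that \<open>\<alpha> \<in> _\<close> by (auto simp: null_semigroup_def intro: ranI)
    moreover have "\<beta> y = None" if "y \<in> L" for y
      using that \<open>\<beta> \<in> _\<close> assms by (auto simp: null_semigroup_def)
    ultimately show "(\<alpha> \<Zsemi> \<beta>) x = None"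
      by (auto simp: pcomp_def map_comp_def split: option.split)
  qed
  have "nilpotent_map \<alpha>" if "\<alpha> \<in> null_semigroup X K L" for \<alpha>
  proof -
    have "ppow \<alpha> (Suc (Suc 0)) = Map.empty"
      using comp[OF that that] by (simp add: pcomp_def map_comp_def)
    then show ?thesis
      unfolding nilpotent_map_def by blast
  qed
  with zero comp show ?thesis
    by (auto simp: commutative_nilpotent_subsemigroup_def subsemigroup_def null_semigroup_def)
qed

lemma balanced_null_semigroup_properties:
  assumes "finite X" "balanced_null_semigroup X S"
  shows "commutative_nilpotent_subsemigroup X S"
    and "card S = num_partial_inj (card X) (card X div 2)"
proof -
  from assms(2) obtain K L where KL: "K \<inter> L = {}" "K \<union> L = X" "S = null_semigroup X K L"
    and "card K = card X div 2 \<or> card K = card X - card X div 2"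
    unfolding balanced_null_semigroup_def by blast
  then have "num_partial_inj (card X) (card K) = num_partial_inj (card X) (card X div 2)"
    by (metis div_le_dividend num_partial_inj_sym)
  then show "card S = num_partial_inj (card X) (card X div 2)"
    using card_null_semigroup[OF assms(1) KL(1,2)] KL(3) by simp
  show "commutative_nilpotent_subsemigroup X S"
    using null_semigroup_commutative_nilpotent KL by simp
qed

section \<open>Points outside all images\<close>

text \<open>The set called \<open>A\<close> in the overview: the vertices without incoming edge in
  the digraph with an edge from \<open>x\<close> to \<open>y\<close> whenever some element of
  \<open>S\<close> maps \<open>x\<close> to \<open>y\<close>.\<close>

definition sources :: "'a set \<Rightarrow> ('a \<rightharpoonup> 'a) set \<Rightarrow> 'a set" where
  "sources X S = X - (\<Union>\<alpha>\<in>S. ran \<alpha>)"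

lemma pcomp_Some_iff: "(\<alpha> \<Zsemi> \<beta>) x = Some z \<longleftrightarrow> (\<exists>y. \<alpha> x = Some y \<and> \<beta> y = Some z)"
  by (auto simp: pcomp_def map_comp_Some_iff)

lemma pcomp_Some: "\<alpha> x = Some y \<Longrightarrow> (\<alpha> \<Zsemi> \<beta>) x = \<beta> y"
  by (simp add: pcomp_def)

lemma nilpotent_map_no_fixpoint:
  assumes "nilpotent_map \<alpha>"
  shows "\<alpha> x \<noteq> Some x"
proof
  assume "\<alpha> x = Some x"
  then have "ppow \<alpha> p x = Some x" for p
    by (induction p) (auto simp: pcomp_Some)
  with assms show False
    unfolding nilpotent_map_def by (metis option.distinct(1))
qed

context
  fixes X :: "'a set" and S
  assumes fin: "finite X" and S: "commutative_nilpotent_subsemigroup X S"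
begin

lemma pcomp_closed: "\<alpha> \<in> S \<Longrightarrow> \<beta> \<in> S \<Longrightarrow> \<alpha> \<Zsemi> \<beta> \<in> S"
  using S by (simp add: commutative_nilpotent_subsemigroup_def subsemigroup_def)

lemma pcomp_commute: "\<alpha> \<in> S \<Longrightarrow> \<beta> \<in> S \<Longrightarrow> \<alpha> \<Zsemi> \<beta> = \<beta> \<Zsemi> \<alpha>"
  using S by (simp add: commutative_nilpotent_subsemigroup_def)

lemma no_fixpoint: "\<alpha> \<in> S \<Longrightarrow> \<alpha> x \<noteq> Some x"
  using S by (simp add: commutative_nilpotent_subsemigroup_def nilpotent_map_no_fixpoint)

lemma in_sym_inv_semigroup: "\<alpha> \<in> S \<Longrightarrow> \<alpha> \<in> sym_inv_semigroup X"
  using S by (auto simp: commutative_nilpotent_subsemigroup_def subsemigroup_def)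

lemma dom_ran_in: "\<alpha> \<in> S \<Longrightarrow> \<alpha> x = Some y \<Longrightarrow> x \<in> X \<and> y \<in> X"
  using in_sym_inv_semigroup[of \<alpha>] domI[of \<alpha> x y] ranI[of \<alpha> x y]
  by (auto simp only: sym_inv_semigroup_def mem_Collect_eq)

lemma target_not_source: "\<alpha> \<in> S \<Longrightarrow> \<alpha> x = Some y \<Longrightarrow> y \<notin> sources X S"
  using ranI[of \<alpha> x y] by (auto simp only: sources_def)

text \<open>The edge relation \<open>r\<close> is transitive by closure of \<open>S\<close> and
  irreflexive by nilpotency, hence acyclic and, on finite \<open>X\<close>, well-founded. A minimal
  predecessor of \<open>y\<close> is the desired source; transitivity makes a single element of
  \<open>S\<close> suffice.\<close>

lemma source_exists:
  assumes "y \<in> X" "y \<notin> sources X S"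
  shows "\<exists>x\<in>sources X S. \<exists>\<alpha>\<in>S. \<alpha> x = Some y"
proof -
  define r where "r = {(x, y). \<exists>\<alpha>\<in>S. \<alpha> x = Some y}"
  have tr: "trans r"
  proof (rule transI)
    fix x y z assume "(x, y) \<in> r" "(y, z) \<in> r"
    then obtain \<alpha> \<beta> where "\<alpha> \<in> S" "\<beta> \<in> S" "\<alpha> x = Some y" "\<beta> y = Some z"
      by (auto simp: r_def)
    then have "(\<alpha> \<Zsemi> \<beta>) x = Some z" "\<alpha> \<Zsemi> \<beta> \<in> S"
      by (simp_all add: pcomp_Some pcomp_closed)
    then show "(x, z) \<in> r"
      unfolding r_def by blast
  qed
  have "(x, x) \<notin> r" for x
    using no_fixpoint unfolding r_def by blast
  then have "acyclic r"
    by (simp add: acyclic_def trancl_id[OF tr])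
  moreover have "r \<subseteq> X \<times> X"
    using dom_ran_in unfolding r_def by blast
  then have "finite r"
    using fin by (meson finite_SigmaI finite_subset)
  ultimately have wf: "wf r"
    using finite_acyclic_wf by blast
  obtain x0 where "x0 \<in> {x. (x, y) \<in> r}"
    using assms unfolding sources_def r_def ran_def by blast
  then obtain x where "x \<in> {x. (x, y) \<in> r}" and min: "\<And>z. (z, x) \<in> r \<Longrightarrow> z \<notin> {x. (x, y) \<in> r}"
    by (rule wfE_min[OF wf]) blast
  then have x: "(x, y) \<in> r"
    by simp
  \<comment> \<open>A predecessor of \<open>x\<close> would also be one of \<open>y\<close>, against
    minimality.\<close>
  have "(z, x) \<notin> r" for z
    using min[of z] transD[OF tr _ x, of z] by blast
  moreover have "x \<in> X"
    using x dom_ran_in unfolding r_def by blast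
  ultimately have "x \<in> sources X S"
    unfolding sources_def r_def ran_def by blast
  with x show ?thesis
    unfolding r_def by blast
qed

section \<open>The upper bound, by restriction to the sources\<close>

lemma inj_on_restrict_sources: "inj_on (\<lambda>\<gamma>. \<gamma> |` sources X S) S"
proof (rule inj_onI, rule ext)
  fix \<gamma> \<delta> y
  assume \<gamma>\<delta>: "\<gamma> \<in> S" "\<delta> \<in> S" and eq: "\<gamma> |` sources X S = \<delta> |` sources X S"
  have on: "\<gamma> x = \<delta> x" if "x \<in> sources X S" for x
    using fun_cong[OF eq, of x] that by simp
  consider "y \<notin> X" | "y \<in> sources X S" | "y \<in> X" "y \<notin> sources X S"
    by blast
  then show "\<gamma> y = \<delta> y"
  proof cases
    case 1
    then show ?thesis
      using dom_ran_in[OF \<gamma>\<delta>(1), of y] dom_ran_in[OF \<gamma>\<delta>(2), of y]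
      by (metis option.exhaust)
  next
    case 3
    then obtain x \<alpha> where x: "x \<in> sources X S" "\<alpha> \<in> S" "\<alpha> x = Some y"
      using source_exists by blast
    \<comment> \<open>Commuting with \<open>\<alpha>\<close> moves the evaluation from
      \<open>y\<close> to the source \<open>x\<close>, where \<open>\<gamma>\<close> and
      \<open>\<delta>\<close> agree.\<close>
    have "\<gamma> y = (\<gamma> \<Zsemi> \<alpha>) x"
      using pcomp_Some[of \<alpha> x y \<gamma>] pcomp_commute[OF \<gamma>\<delta>(1) x(2)] x(3) by simp
    also have "\<dots> = (\<delta> \<Zsemi> \<alpha>) x"
      using on[OF x(1)] by (simp add: pcomp_def map_comp_def)
    also have "\<dots> = \<delta> y"
      using pcomp_Some[of \<alpha> x y \<delta>] pcomp_commute[OF \<gamma>\<delta>(2) x(2)] x(3) by simp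
    finally show ?thesis .
  qed (use on in auto)
qed

lemma restrict_sources_subset:
  "(\<lambda>\<gamma>. \<gamma> |` sources X S) ` S \<subseteq> null_semigroup X (sources X S) (X - sources X S)"
proof
  fix \<beta> assume "\<beta> \<in> (\<lambda>\<gamma>. \<gamma> |` sources X S) ` S"
  then obtain \<gamma> where \<gamma>: "\<gamma> \<in> S" and \<beta>: "\<beta> = \<gamma> |` sources X S"
    by blast
  have "ran \<beta> \<subseteq> X - sources X S"
    using dom_ran_in[OF \<gamma>] target_not_source[OF \<gamma>]
    by (auto simp: \<beta> ran_def restrict_map_def split: if_splits)
  moreover have "inj_on \<beta> (dom \<beta>)"
    using in_sym_inv_semigroup[OF \<gamma>] by (auto simp: \<beta> sym_inv_semigroup_def inj_on_def)
  ultimately show "\<beta> \<in> null_semigroup X (sources X S) (X - sources X S)"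
    using \<beta> by (auto simp: null_semigroup_def sym_inv_semigroup_def sources_def)
qed

lemma card_le_num_partial_inj:
  "finite S" "card S \<le> num_partial_inj (card X) (card (sources X S))"
proof -
  have fin_null: "finite (null_semigroup X (sources X S) (X - sources X S))"
    using fin by (rule finite_null_semigroup)
  show "finite S"
    using finite_imageD[OF _ inj_on_restrict_sources] finite_subset[OF restrict_sources_subset fin_null]
    by blast
  have "card S \<le> card (null_semigroup X (sources X S) (X - sources X S))"
    using card_inj_on_le[OF inj_on_restrict_sources restrict_sources_subset fin_null] .
  also have "\<dots> = num_partial_inj (card X) (card (sources X S))"
    using fin by (intro card_null_semigroup) (auto simp: sources_def)
  finally show "card S \<le> num_partial_inj (card X) (card (sources X S))" .
qed

lemma card_sources_le: "card (sources X S) \<le> card X"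
  using fin by (intro card_mono) (auto simp: sources_def)

lemma card_le_max: "card S \<le> num_partial_inj (card X) (card X div 2)"
  using card_le_num_partial_inj(2) num_partial_inj_le[OF card_sources_le] by (rule order_trans)

section \<open>The case of equality in the bound\<close>

lemma dom_subset_sources:
  assumes full: "card S = num_partial_inj (card X) (card (sources X S))"
    and two: "2 \<le> card (sources X S)" and \<gamma>: "\<gamma> \<in> S"
  shows "dom \<gamma> \<subseteq> sources X S"
proof
  let ?A = "sources X S"
  \<comment> \<open>Equality of the finite cardinalities turns the injective restriction map into a
    surjection, so every one-point map from a source to a non-source is the restriction of an
    element of \<open>S\<close>.\<close>
  have "card ((\<lambda>\<gamma>. \<gamma> |` ?A) ` S) = card (null_semigroup X ?A (X - ?A))"
    unfolding card_image[OF inj_on_restrict_sources] full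
    using fin by (intro card_null_semigroup[symmetric]) (auto simp: sources_def)
  then have onto: "(\<lambda>\<gamma>. \<gamma> |` ?A) ` S = null_semigroup X ?A (X - ?A)"
    by (intro card_subset_eq finite_null_semigroup[OF fin] restrict_sources_subset)
  have point: "\<exists>\<delta>\<in>S. \<delta> |` ?A = [x \<mapsto> y]" if "x \<in> ?A" "y \<in> X - ?A" for x y
  proof -
    have "[x \<mapsto> y] \<in> null_semigroup X ?A (X - ?A)"
      using that by (auto simp: null_semigroup_def sym_inv_semigroup_def sources_def)
    with onto show ?thesis
      by (metis (no_types, lifting) imageE)
  qed
  have at: "\<delta> x = (if x = u then Some v else None)" if "\<delta> |` ?A = [u \<mapsto> v]" "x \<in> ?A" for \<delta> u v x
    using fun_cong[OF that(1), of x] that(2) by auto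
  \<comment> \<open>An extension of a one-point map is undefined off the sources: \<open>y\<close>
    is reached by some \<open>\<epsilon>\<close> from a second source \<open>x\<close>, at which
    \<open>\<delta>\<close> is undefined.\<close>
  have single: "\<delta> y = None"
    if \<delta>: "\<delta> \<in> S" "\<delta> |` ?A = [u \<mapsto> v]" and y: "y \<in> X - ?A" for \<delta> u v y
  proof -
    obtain x where x: "x \<in> ?A" "x \<noteq> u"
    proof -
      have "\<not> ?A \<subseteq> {u}"
        using two card_mono[of "{u}" ?A] by auto
      then show ?thesis
        using that by blast
    qed
    obtain \<epsilon> where \<epsilon>: "\<epsilon> \<in> S" "\<epsilon> |` ?A = [x \<mapsto> y]"
      using point[OF x(1) y] by blast
    have "\<delta> y = (\<delta> \<Zsemi> \<epsilon>) x"
      using pcomp_Some[of \<epsilon> x y \<delta>] at[OF \<epsilon>(2) x(1)] pcomp_commute[OF \<delta>(1) \<epsilon>(1)] by simp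
    also have "\<dots> = None"
      using at[OF \<delta>(2) x(1)] x(2) by (simp add: pcomp_def)
    finally show ?thesis .
  qed
  fix y assume "y \<in> dom \<gamma>"
  then obtain z where z: "\<gamma> y = Some z"
    by blast
  show "y \<in> ?A"
  proof (rule ccontr)
    assume "y \<notin> ?A"
    then have y: "y \<in> X - ?A"
      using dom_ran_in[OF \<gamma> z] by simp
    then obtain x where x: "x \<in> ?A"
      using source_exists by blast
    obtain \<epsilon> where \<epsilon>: "\<epsilon> \<in> S" "\<epsilon> |` ?A = [x \<mapsto> y]"
      using point[OF x y] by blast
    \<comment> \<open>If \<open>\<gamma>\<close> were defined at the non-source \<open>y\<close>,
      commuting with \<open>\<epsilon>\<close> would make \<open>\<epsilon>\<close> defined at
      \<open>w\<close>, the image of \<open>x\<close> under \<open>\<gamma>\<close>. But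
      \<open>w\<close> is a non-source, contrary to \<open>single\<close>.\<close>
    have "(\<gamma> \<Zsemi> \<epsilon>) x = Some z"
      using pcomp_Some[of \<epsilon> x y \<gamma>] at[OF \<epsilon>(2) x] pcomp_commute[OF \<gamma> \<epsilon>(1)] z by simp
    then obtain w where w: "\<gamma> x = Some w" "\<epsilon> w = Some z"
      by (auto simp: pcomp_Some_iff)
    then have "w \<in> X - ?A"
      using dom_ran_in[OF \<gamma>] target_not_source[OF \<gamma>] by blast
    with single[OF \<epsilon>] w(2) show False
      by simp
  qed
qed

text \<open>A number of sources other than the two halves would make the bound too small. Once all
  domains consist of sources, \<open>S\<close> lies in a null semigroup of the same finite size and
  equals it.\<close>

lemma max_imp_balanced:
  assumes max: "card S = num_partial_inj (card X) (card X div 2)"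
    and n: "card X \<ge> 1" "card X \<notin> {1, 3}"
  shows "balanced_null_semigroup X S"
proof -
  let ?A = "sources X S" and ?n = "card X"
  have half: "card ?A = ?n div 2 \<or> card ?A = ?n - ?n div 2"
    using num_partial_inj_less[OF card_sources_le] card_le_num_partial_inj(2) max
    by (metis leD)
  then have full: "card S = num_partial_inj ?n (card ?A)"
    using max num_partial_inj_sym[of "?n div 2" ?n] by auto
  have AX: "?A \<subseteq> X"
    by (auto simp: sources_def)
  have diff: "card (X - ?A) = ?n - card ?A"
    using fin AX by (meson card_Diff_subset finite_subset)
  \<comment> \<open>For two points there is only one source, so \<open>dom_subset_sources\<close>
    does not apply. The only non-source is \<open>b\<close>, and a map defined at \<open>b\<close>
    would have to fix it.\<close>
  have dom: "dom \<gamma> \<subseteq> ?A" if \<gamma>: "\<gamma> \<in> S" for \<gamma>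
  proof (cases "?n = 2")
    case True
    then have "card (X - ?A) = 1"
      using half diff by auto
    then obtain b where b: "X - ?A = {b}"
      using card_1_singletonE by blast
    show ?thesis
    proof
      fix y assume "y \<in> dom \<gamma>"
      then obtain z where z: "\<gamma> y = Some z"
        by blast
      then have "z \<in> X - ?A" "y \<in> X"
        using dom_ran_in[OF \<gamma> z] target_not_source[OF \<gamma> z] by blast+
      moreover have "y \<noteq> z"
        using no_fixpoint[OF \<gamma>, of y] z by metis
      ultimately show "y \<in> ?A"
        using b by (metis DiffI singletonD)
    qed
  next
    case False
    \<comment> \<open>From four points on, both halves have at least two elements. With three points
      there may be a single source: the map \<open>a\<close> to \<open>b\<close> to \<open>c\<close>
      generates a non-null semigroup of the maximal order 3.\<close>
    then have "?n \<ge> 4"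
      using n by auto
    then have "2 \<le> card ?A"
      using half by auto
    from dom_subset_sources[OF full this \<gamma>] show ?thesis .
  qed
  have "S \<subseteq> null_semigroup X ?A (X - ?A)"
  proof
    fix \<gamma> assume \<gamma>: "\<gamma> \<in> S"
    have "ran \<gamma> \<subseteq> X - ?A"
      using dom_ran_in[OF \<gamma>] target_not_source[OF \<gamma>] unfolding ran_def by blast
    with dom[OF \<gamma>] in_sym_inv_semigroup[OF \<gamma>] show "\<gamma> \<in> null_semigroup X ?A (X - ?A)"
      by (simp add: null_semigroup_def)
  qed
  moreover have "card S = card (null_semigroup X ?A (X - ?A))"
    using card_null_semigroup[OF fin, of ?A "X - ?A"] full AX by (simp add: Un_absorb1)
  ultimately have eq: "S = null_semigroup X ?A (X - ?A)"
    by (rule card_subset_eq[OF finite_null_semigroup[OF fin]])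
  have cards: "card ?A = ?n div 2 \<and> card (X - ?A) = ?n - ?n div 2 \<or>
      card (X - ?A) = ?n div 2 \<and> card ?A = ?n - ?n div 2"
    using half diff by linarith
  have "?n \<ge> 2"
    using n by simp
  then have "card ?A > 0" "card (X - ?A) > 0"
    using cards by linarith+
  then have "?A \<noteq> {}" "X - ?A \<noteq> {}"
    by (simp_all only: card_gt_0_iff not_False_eq_True)
  with eq cards AX show ?thesis
    unfolding balanced_null_semigroup_def
    by (intro exI[of _ ?A] exI[of _ "X - ?A"]) (simp add: Un_absorb1)
qed

end

theorem theorem4p19:
  fixes X :: "'a set" and n m lam :: nat
  assumes "finite X" and "card X = n" and "n \<ge> 1"
    and "m = n div 2"
    and "lam = (\<Sum>r=0..m. (m choose r) * ((n - m) choose r) * fact r)"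
  shows "((\<exists>S. commutative_nilpotent_subsemigroup X S \<and> card S = lam) \<and>
          (\<forall>S. commutative_nilpotent_subsemigroup X S \<longrightarrow> card S \<le> lam)) \<and>
         (n \<notin> {1, 3} \<longrightarrow>
          (\<forall>S. commutative_nilpotent_subsemigroup X S \<and> card S = lam \<longleftrightarrow>
               balanced_null_semigroup X S))"
proof -
  have lam: "lam = num_partial_inj (card X) (card X div 2)"
    using assms num_partial_inj_half by simp
  \<comment> \<open>Any block of size \<open>card X div 2\<close> gives a null semigroup attaining
    the bound.\<close>
  obtain K where K: "K \<subseteq> X" "card K = card X div 2"
    using obtain_subset_with_card_n[of "card X div 2" X] by auto
  then have "card (null_semigroup X K (X - K)) = lam"
    unfolding lam using card_null_semigroup[OF assms(1), of K "X - K"] by auto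
  moreover have "commutative_nilpotent_subsemigroup X (null_semigroup X K (X - K))"
    by (rule null_semigroup_commutative_nilpotent) auto
  moreover have "commutative_nilpotent_subsemigroup X S \<and> card S = lam \<longleftrightarrow> balanced_null_semigroup X S"
    if "n \<notin> {1, 3}" for S
    using max_imp_balanced[OF assms(1), of S] balanced_null_semigroup_properties[OF assms(1), of S]
      assms(2,3) that unfolding lam by blast
  ultimately show ?thesis
    using card_le_max[OF assms(1)] unfolding lam by blast
qed

end
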